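(* Let $S$ be a group-bound inverse semigroup and $x,y\in S$. Then the following conditions are equivalent: (a) $x\sim y$; (b) $x\approx y$; (c) there is $z\in S$ such that $z=a\cdot x=b\cdot y$ for some $a,b\in S^1$ (in particular, both $a\cdot x$ and $b\cdot y$ are defined).
   Context: $S^1$ denotes $S$ with an identity element adjoined if $S$ has none (and $S^1=S$ otherwise); if $S$ is inverse, so is $S^1$, and $a^{-1}$ denotes the inverse of $a$ in the inverse-semigroup sense. A semigroup $S$ is group-bound if for each $x\in S$ there is $k\in\{1,2,\dots\}$ such that $x^k$ lies in a subgroup of $S$; then $e_x$ denotes the idempotent (identity element) of the subgroup containing such an $x^k$. Conjugacy $\sim$: for $x,y\in S$ write $x\sim_p y$ if there are $u,v\in S^1$ such that $x=uv$ and $y=vu$. The relation $\sim$ on $S$ is the transitive closure of $\sim_p$. Partial action: let $S$ be inverse and group-bound. Let $\geq$ be the natural partial order on $S^1$; for idempotents $e,f$ one has $e\geq f$ if and only if $ef=fe=f$. For $a\in S^1$ and $x\in S$, put $a\cdot x=axa^{-1}$ if $a^{-1}a\geq e_x$; otherwise $a\cdot x$ is not defined. Conjugacy in the action sense $\approx$: for $x,y\in S$ write $x\approx_p y$ if there is some $a\in S^1$ such that $y=a\cdot x$ or $x=a\cdot y$ (where the equality includes that the right-hand side is defined). The relation $\approx$ on $S$ is the transitive closure of $\approx_p$. *)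

theory Defs
  imports "HOL-Algebra.Group"
begin

text \<open>A semigroup is a carrier set together with a binary operation on the ambient type.\<close>

locale sgroup =
  fixes S :: "'a set" and mul :: "'a \<Rightarrow> 'a \<Rightarrow> 'a"
  assumes mul_closed: "\<lbrakk>x \<in> S; y \<in> S\<rbrakk> \<Longrightarrow> mul x y \<in> S"
    and mul_assoc: "\<lbrakk>x \<in> S; y \<in> S; z \<in> S\<rbrakk> \<Longrightarrow> mul (mul x y) z = mul x (mul y z)"

definition is_inverse_of :: "'a set \<Rightarrow> ('a \<Rightarrow> 'a \<Rightarrow> 'a) \<Rightarrow> 'a \<Rightarrow> 'a \<Rightarrow> bool" where
  "is_inverse_of S mul a b \<longleftrightarrow> b \<in> S \<and> mul (mul a b) a = a \<and> mul (mul b a) b = b"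

locale inverse_sgroup = sgroup +
  assumes ex1_inverse: "a \<in> S \<Longrightarrow> \<exists>!b. is_inverse_of S mul a b"

definition sg_inv :: "'a set \<Rightarrow> ('a \<Rightarrow> 'a \<Rightarrow> 'a) \<Rightarrow> 'a \<Rightarrow> 'a" where
  "sg_inv S mul a = (THE b. is_inverse_of S mul a b)"

definition idempotents :: "'a set \<Rightarrow> ('a \<Rightarrow> 'a \<Rightarrow> 'a) \<Rightarrow> 'a set" where
  "idempotents S mul = {e \<in> S. mul e e = e}"

text \<open>The natural partial order of an inverse semigroup; \<open>nat_le S mul a b\<close> means \<open>a \<le> b\<close>.\<close>

definition nat_le :: "'a set \<Rightarrow> ('a \<Rightarrow> 'a \<Rightarrow> 'a) \<Rightarrow> 'a \<Rightarrow> 'a \<Rightarrow> bool" where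
  "nat_le S mul a b \<longleftrightarrow> (\<exists>e\<in>idempotents S mul. a = mul e b)"

text \<open>Powers with positive exponent; the value at exponent \<open>0\<close> is never used.\<close>

definition sg_pow :: "('a \<Rightarrow> 'a \<Rightarrow> 'a) \<Rightarrow> 'a \<Rightarrow> nat \<Rightarrow> 'a" where
  "sg_pow mul x k = ((\<lambda>z. mul z x) ^^ (k - 1)) x"

definition subgroup_with_identity :: "'a set \<Rightarrow> ('a \<Rightarrow> 'a \<Rightarrow> 'a) \<Rightarrow> 'a set \<Rightarrow> 'a \<Rightarrow> bool" where
  "subgroup_with_identity S mul G e \<longleftrightarrow> G \<subseteq> S \<and> group \<lparr>carrier = G, mult = mul, one = e\<rparr>"

definition group_bound :: "'a set \<Rightarrow> ('a \<Rightarrow> 'a \<Rightarrow> 'a) \<Rightarrow> bool" where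
  "group_bound S mul \<longleftrightarrow>
     (\<forall>x\<in>S. \<exists>k\<ge>1. \<exists>G e. subgroup_with_identity S mul G e \<and> sg_pow mul x k \<in> G)"

text \<open>The idempotent \<open>e\<^sub>x\<close>.\<close>

definition pow_idem :: "'a set \<Rightarrow> ('a \<Rightarrow> 'a \<Rightarrow> 'a) \<Rightarrow> 'a \<Rightarrow> 'a" where
  "pow_idem S mul x =
     (THE e. \<exists>k\<ge>1. \<exists>G. subgroup_with_identity S mul G e \<and> sg_pow mul x k \<in> G)"

text \<open>
  The semigroup \<open>S\<^sup>1\<close> lives on a type with an extra point \<open>One\<close>, which belongs to the carrier
  only if \<open>S\<close> has no identity element; \<open>S\<close> is embedded via \<open>Elem\<close>.
\<close>

datatype 'a adj = Elem (elem: 'a) | One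

definition has_identity :: "'a set \<Rightarrow> ('a \<Rightarrow> 'a \<Rightarrow> 'a) \<Rightarrow> bool" where
  "has_identity S mul \<longleftrightarrow> (\<exists>e\<in>S. \<forall>x\<in>S. mul e x = x \<and> mul x e = x)"

definition S1 :: "'a set \<Rightarrow> ('a \<Rightarrow> 'a \<Rightarrow> 'a) \<Rightarrow> 'a adj set" where
  "S1 S mul = (if has_identity S mul then Elem ` S else insert One (Elem ` S))"

fun mul1 :: "('a \<Rightarrow> 'a \<Rightarrow> 'a) \<Rightarrow> 'a adj \<Rightarrow> 'a adj \<Rightarrow> 'a adj" where
  "mul1 mul (Elem x) (Elem y) = Elem (mul x y)"
| "mul1 mul One b = b"
| "mul1 mul a One = a"

definition conj_p :: "'a set \<Rightarrow> ('a \<Rightarrow> 'a \<Rightarrow> 'a) \<Rightarrow> 'a \<Rightarrow> 'a \<Rightarrow> bool" where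
  "conj_p S mul x y \<longleftrightarrow> x \<in> S \<and> y \<in> S \<and>
     (\<exists>u\<in>S1 S mul. \<exists>v\<in>S1 S mul. Elem x = mul1 mul u v \<and> Elem y = mul1 mul v u)"

definition conj_rel :: "'a set \<Rightarrow> ('a \<Rightarrow> 'a \<Rightarrow> 'a) \<Rightarrow> 'a \<Rightarrow> 'a \<Rightarrow> bool" where
  "conj_rel S mul = (conj_p S mul)\<^sup>+\<^sup>+"

text \<open>
  The partial action of \<open>S\<^sup>1\<close> on \<open>S\<close>, with \<open>None\<close> for undefined. For \<open>x \<in> S\<close> the product
  \<open>a x a\<^sup>-\<^sup>1\<close> is always of the form \<open>Elem z\<close>, so the use of \<open>elem\<close> is harmless.
\<close>

definition act :: "'a set \<Rightarrow> ('a \<Rightarrow> 'a \<Rightarrow> 'a) \<Rightarrow> 'a adj \<Rightarrow> 'a \<Rightarrow> 'a option" where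
  "act S mul a x =
     (let T = S1 S mul; m = mul1 mul; a' = sg_inv T m a in
      if nat_le T m (Elem (pow_idem S mul x)) (m a' a)
      then Some (elem (m (m a (Elem x)) a')) else None)"

definition act_conj_p :: "'a set \<Rightarrow> ('a \<Rightarrow> 'a \<Rightarrow> 'a) \<Rightarrow> 'a \<Rightarrow> 'a \<Rightarrow> bool" where
  "act_conj_p S mul x y \<longleftrightarrow> x \<in> S \<and> y \<in> S \<and>
     (\<exists>a\<in>S1 S mul. act S mul a x = Some y \<or> act S mul a y = Some x)"

definition act_conj :: "'a set \<Rightarrow> ('a \<Rightarrow> 'a \<Rightarrow> 'a) \<Rightarrow> 'a \<Rightarrow> 'a \<Rightarrow> bool" where
  "act_conj S mul = (act_conj_p S mul)\<^sup>+\<^sup>+"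

end

theory Submission
  imports Defs
begin

text \<open>
  Write \<open>e\<^sub>x\<close> for the idempotent of the subgroup containing a power of \<open>x\<close>; it commutes with \<open>x\<close>.
  Call \<open>x\<close> and \<open>y\<close> linked if some \<open>b\<close> with \<open>b\<inverse>b = e\<^sub>x\<close> and \<open>bb\<inverse> = e\<^sub>y\<close> satisfies
  \<open>b x b\<inverse> = y e\<^sub>y\<close>. This is an equivalence relation. If \<open>x = uv\<close> and \<open>y = vu\<close>, then \<open>v e\<^sub>x = e\<^sub>y v\<close>
  links \<open>x\<close> to \<open>y\<close>, so \<open>\<sim>\<close> implies linkedness, and linked elements share the translate
  \<open>y e\<^sub>y = b \<cdot> x = e\<^sub>y \<cdot> y\<close>. Conversely, \<open>x \<sim> x\<^sup>n\<^sup>+\<^sup>1 x\<^sup>-\<^sup>n\<close> for all \<open>n\<close>, hence \<open>x \<sim> x e\<^sub>x\<close>. If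
  \<open>g = a\<inverse>a \<ge> e\<^sub>x\<close>, then some power of \<open>x g\<close> equals the corresponding power of \<open>x\<close>, so that
  \<open>x \<sim> x e\<^sub>x = x g e\<^sub>x \<sim> x g \<sim>\<^sub>p a x a\<inverse>\<close>.
\<close>

section \<open>Powers in a semigroup\<close>

context sgroup
begin

notation mul (infixl \<open>\<cdot>\<close> 70)

text \<open>With \<open>mul_assoc\<close> as a simp rule products nest to the right, so an equation
  for \<open>a \<cdot> b\<close> no longer matches once another factor follows. This rule lifts such
  equations.\<close>

lemma mul_left_eq:
  "a \<cdot> b = c \<Longrightarrow> a \<in> S \<Longrightarrow> b \<in> S \<Longrightarrow> x \<in> S \<Longrightarrow> a \<cdot> (b \<cdot> x) = c \<cdot> x"
  using mul_assoc[of a b x] by simp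

lemmas mul_closed [simp] and mul_assoc [simp]

lemma sg_pow_1 [simp]: "sg_pow mul x (Suc 0) = x"
  by (simp add: sg_pow_def)

lemma sg_pow_Suc [simp]: "sg_pow mul x (Suc (Suc n)) = sg_pow mul x (Suc n) \<cdot> x"
  by (simp add: sg_pow_def)

lemma sg_pow_Suc_closed: "x \<in> S \<Longrightarrow> sg_pow mul x (Suc n) \<in> S"
  by (induction n) simp_all

lemma sg_pow_closed [simp]: "x \<in> S \<Longrightarrow> 0 < k \<Longrightarrow> sg_pow mul x k \<in> S"
  using sg_pow_Suc_closed by (cases k) auto

lemma sg_pow_commute: "x \<in> S \<Longrightarrow> 0 < k \<Longrightarrow> x \<cdot> sg_pow mul x k = sg_pow mul x k \<cdot> x"
proof -
  assume x: "x \<in> S" and "0 < k"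
  have "x \<cdot> sg_pow mul x (Suc n) = sg_pow mul x (Suc n) \<cdot> x" for n
  proof (induction n)
    case (Suc n)
    have "x \<cdot> sg_pow mul x (Suc (Suc n)) = (x \<cdot> sg_pow mul x (Suc n)) \<cdot> x"
      using x by simp
    then show ?case using Suc x by simp
  qed simp
  then show ?thesis using \<open>0 < k\<close> by (cases k) auto
qed

lemma sg_pow_add:
  "x \<in> S \<Longrightarrow> 0 < k \<Longrightarrow> 0 < l \<Longrightarrow> sg_pow mul x (k + l) = sg_pow mul x k \<cdot> sg_pow mul x l"
proof -
  assume x: "x \<in> S" and "0 < k" "0 < l"
  have "sg_pow mul x (Suc m + Suc n) = sg_pow mul x (Suc m) \<cdot> sg_pow mul x (Suc n)" for m n
  proof (induction n)
    case (Suc n)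
    have "sg_pow mul x (Suc m + Suc (Suc n)) = sg_pow mul x (Suc m + Suc n) \<cdot> x"
      by simp
    then show ?case unfolding Suc using x by simp
  qed simp
  from this[of "k - 1" "l - 1"] show ?thesis using \<open>0 < k\<close> \<open>0 < l\<close> by (simp del: sg_pow_Suc)
qed

end

section \<open>Inverse semigroups: commuting idempotents and inverses of products\<close>

context inverse_sgroup
begin

abbreviation iv (\<open>_\<^sup>\<star>\<close> [1000] 1000) where "iv a \<equiv> sg_inv S mul a"

abbreviation "E \<equiv> idempotents S mul"

lemma idem_closed: "e \<in> E \<Longrightarrow> e \<in> S"
  and idem_idem: "e \<in> E \<Longrightarrow> e \<cdot> e = e"
  and idemI: "e \<in> S \<Longrightarrow> e \<cdot> e = e \<Longrightarrow> e \<in> E"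
  by (simp_all add: idempotents_def)

declare idem_closed [simp] and idem_idem [simp]

lemma idem_idem_left [simp]: "e \<in> E \<Longrightarrow> x \<in> S \<Longrightarrow> e \<cdot> (e \<cdot> x) = e \<cdot> x"
  using mul_left_eq[of e e e x] by simp

lemma is_inverse_of_iv: "a \<in> S \<Longrightarrow> is_inverse_of S mul a (a\<^sup>\<star>)"
  unfolding sg_inv_def by (rule theI') (rule ex1_inverse)

lemma iv_closed [simp]: "a \<in> S \<Longrightarrow> a\<^sup>\<star> \<in> S"
  using is_inverse_of_iv by (simp add: is_inverse_of_def)

lemma mul_iv_mul [simp]: "a \<in> S \<Longrightarrow> a \<cdot> (a\<^sup>\<star> \<cdot> a) = a"
  using is_inverse_of_iv[of a] by (simp add: is_inverse_of_def)

lemma iv_mul_iv [simp]: "a \<in> S \<Longrightarrow> a\<^sup>\<star> \<cdot> (a \<cdot> a\<^sup>\<star>) = a\<^sup>\<star>"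
  using is_inverse_of_iv[of a] by (simp add: is_inverse_of_def)

lemma mul_iv_mul_left [simp]: "a \<in> S \<Longrightarrow> x \<in> S \<Longrightarrow> a \<cdot> (a\<^sup>\<star> \<cdot> (a \<cdot> x)) = a \<cdot> x"
  using mul_left_eq[of a "a\<^sup>\<star> \<cdot> a" a x] by simp

lemma iv_mul_iv_left [simp]: "a \<in> S \<Longrightarrow> x \<in> S \<Longrightarrow> a\<^sup>\<star> \<cdot> (a \<cdot> (a\<^sup>\<star> \<cdot> x)) = a\<^sup>\<star> \<cdot> x"
  using mul_left_eq[of "a\<^sup>\<star>" "a \<cdot> a\<^sup>\<star>" "a\<^sup>\<star>" x] by simp

lemma iv_eqI:
  assumes "a \<in> S" "b \<in> S" "a \<cdot> (b \<cdot> a) = a" "b \<cdot> (a \<cdot> b) = b"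
  shows "a\<^sup>\<star> = b"
proof -
  have "is_inverse_of S mul a b" using assms by (simp add: is_inverse_of_def)
  then show ?thesis using ex1_inverse is_inverse_of_iv assms(1) by blast
qed

lemma iv_iv [simp]: "a \<in> S \<Longrightarrow> a\<^sup>\<star>\<^sup>\<star> = a"
  by (rule iv_eqI) simp_all

lemma iv_idem [simp]: "e \<in> E \<Longrightarrow> e\<^sup>\<star> = e"
  by (rule iv_eqI) simp_all

lemma mul_iv_idem [simp]: "a \<in> S \<Longrightarrow> a \<cdot> a\<^sup>\<star> \<in> E"
  by (rule idemI) simp_all

lemma iv_mul_idem [simp]: "a \<in> S \<Longrightarrow> a\<^sup>\<star> \<cdot> a \<in> E"
  by (rule idemI) simp_all

text \<open>If \<open>b\<close> is the inverse of \<open>e \<cdot> f\<close>, then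
  \<open>f \<cdot> (b \<cdot> e)\<close> is an inverse too, so uniqueness gives
  \<open>b = f \<cdot> (b \<cdot> e)\<close>, which squares to itself. An idempotent is its own
  inverse, so \<open>e \<cdot> f\<close>, the inverse of \<open>b\<close>, equals
  \<open>b\<close>.\<close>

lemma idem_mul [simp]:
  assumes "e \<in> E" "f \<in> E"
  shows "e \<cdot> f \<in> E"
proof -
  define b where "b = (e \<cdot> f)\<^sup>\<star>"
  have b: "b \<in> S" using assms by (simp add: b_def)
  have 1: "e \<cdot> (f \<cdot> (b \<cdot> (e \<cdot> f))) = e \<cdot> f"
    using mul_iv_mul[of "e \<cdot> f"] assms b by (simp add: b_def[symmetric])
  have 2: "b \<cdot> (e \<cdot> (f \<cdot> b)) = b"
    using iv_mul_iv[of "e \<cdot> f"] assms b by (simp add: b_def[symmetric])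
  have 3: "b \<cdot> (e \<cdot> (f \<cdot> (b \<cdot> e))) = b \<cdot> e"
  proof -
    have "b \<cdot> (e \<cdot> (f \<cdot> (b \<cdot> e))) = (b \<cdot> (e \<cdot> (f \<cdot> b))) \<cdot> e" using assms b by simp
    then show ?thesis using 2 by simp
  qed
  have "(e \<cdot> f)\<^sup>\<star> = f \<cdot> (b \<cdot> e)"
    by (rule iv_eqI) (use assms b 1 3 in simp_all)
  then have 4: "b = f \<cdot> (b \<cdot> e)" by (simp add: b_def)
  have "(f \<cdot> (b \<cdot> e)) \<cdot> (f \<cdot> (b \<cdot> e)) = f \<cdot> (b \<cdot> e)"
    using assms b 3 by simp
  then have "b \<cdot> b = b" using 4 by metis
  then have "b \<in> E" using b by (intro idemI)
  moreover have "e \<cdot> f = b\<^sup>\<star>" using assms by (simp add: b_def)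
  ultimately show ?thesis by simp
qed

text \<open>Since both products are idempotent, \<open>f \<cdot> e\<close> is an inverse of
  \<open>e \<cdot> f\<close>; but the idempotent \<open>e \<cdot> f\<close> is its own
  inverse.\<close>

lemma idem_commute:
  assumes "e \<in> E" "f \<in> E"
  shows "e \<cdot> f = f \<cdot> e"
proof -
  have "e \<cdot> (f \<cdot> (e \<cdot> f)) = e \<cdot> f" "f \<cdot> (e \<cdot> (f \<cdot> e)) = f \<cdot> e"
    using idem_idem[OF idem_mul[OF assms]] idem_idem[OF idem_mul[OF assms(2,1)]] assms
    by (simp_all del: idem_idem)
  then have "(e \<cdot> f)\<^sup>\<star> = f \<cdot> e"
    by (intro iv_eqI) (use assms in simp_all)
  then show ?thesis using assms by simp
qed

lemma idem_left_commute:
  "e \<in> E \<Longrightarrow> f \<in> E \<Longrightarrow> x \<in> S \<Longrightarrow> e \<cdot> (f \<cdot> x) = f \<cdot> (e \<cdot> x)"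
  using mul_left_eq[OF idem_commute] by simp

text \<open>The idempotents \<open>b \<cdot> b\<^sup>\<star>\<close> and
  \<open>a\<^sup>\<star> \<cdot> a\<close> meet in the middle of the products and may be
  swapped.\<close>

lemma iv_mul:
  assumes "a \<in> S" "b \<in> S"
  shows "(a \<cdot> b)\<^sup>\<star> = b\<^sup>\<star> \<cdot> a\<^sup>\<star>"
proof (rule iv_eqI)
  show "a \<cdot> b \<cdot> (b\<^sup>\<star> \<cdot> a\<^sup>\<star> \<cdot> (a \<cdot> b)) = a \<cdot> b"
    using idem_left_commute[of "b \<cdot> b\<^sup>\<star>" "a\<^sup>\<star> \<cdot> a" b] assms by simp
  show "b\<^sup>\<star> \<cdot> a\<^sup>\<star> \<cdot> (a \<cdot> b \<cdot> (b\<^sup>\<star> \<cdot> a\<^sup>\<star>)) = b\<^sup>\<star> \<cdot> a\<^sup>\<star>"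
    using idem_left_commute[of "a\<^sup>\<star> \<cdot> a" "b \<cdot> b\<^sup>\<star>" "a\<^sup>\<star>"] assms by simp
qed (use assms in simp_all)

section \<open>Powers that lie in subgroups\<close>

definition pow_in_group :: "'a \<Rightarrow> nat \<Rightarrow> 'a \<Rightarrow> bool" where
  "pow_in_group x k e \<longleftrightarrow> 0 < k \<and> e \<in> E \<and>
     sg_pow mul x k \<cdot> (sg_pow mul x k)\<^sup>\<star> = e \<and> (sg_pow mul x k)\<^sup>\<star> \<cdot> sg_pow mul x k = e"

text \<open>The group inverse of the power is also its semigroup inverse. Hence membership in a
  subgroup can be expressed without mentioning \<open>G\<close>.\<close>

lemma pow_in_groupI:
  assumes "subgroup_with_identity S mul G e" "sg_pow mul x k \<in> G" "k \<ge> 1"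
  shows "pow_in_group x k e"
proof -
  let ?G = "\<lparr>carrier = G, mult = mul, one = e\<rparr>" and ?g = "sg_pow mul x k"
  have G: "G \<subseteq> S" "group ?G" using assms by (simp_all add: subgroup_with_identity_def)
  interpret group ?G by (rule G)
  define h where "h = inv\<^bsub>?G\<^esub> ?g"
  have h: "h \<in> G" "h \<cdot> ?g = e" "?g \<cdot> h = e"
    using assms(2) l_inv[of ?g] r_inv[of ?g] inv_closed[of ?g] by (simp_all add: h_def)
  have e: "e \<in> G" "e \<cdot> e = e" "e \<cdot> h = h" "?g \<cdot> e = ?g" "h \<cdot> e = h"
    using one_closed l_one[of e] l_one[of h] r_one[of ?g] r_one[of h] assms(2) h by simp_all
  have "?g\<^sup>\<star> = h"
    by (rule iv_eqI) (use h e G assms(2) in auto)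
  then show ?thesis using h e G assms(3) by (auto simp: pow_in_group_def intro: idemI)
qed

text \<open>Elements \<open>g\<close> and \<open>h\<close> whose products with their inverses on
  either side all equal \<open>e\<close> have a product of the same kind. Passing to multiples of
  \<open>k\<close> lets two exponents be replaced by a common one.\<close>

lemma pow_in_group_mult:
  assumes "x \<in> S" "pow_in_group x k e" "0 < m"
  shows "pow_in_group x (m * k) e"
proof -
  have "pow_in_group x (Suc n * k) e" for n
  proof (induction n)
    case (Suc n)
    let ?h = "sg_pow mul x (Suc n * k)" and ?g = "sg_pow mul x k"
    have k: "0 < k" "0 < Suc n * k" "e \<in> E" using assms by (auto simp: pow_in_group_def)
    have p: "sg_pow mul x (Suc (Suc n) * k) = ?g \<cdot> ?h"
      using sg_pow_add[of x k "Suc n * k"] assms(1) k by simp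
    have S: "?g \<in> S" "?h \<in> S" using assms(1) k by (simp_all del: mult_Suc)
    have g: "?g \<cdot> ?g\<^sup>\<star> = e" "?g\<^sup>\<star> \<cdot> ?g = e" and h: "?h \<cdot> ?h\<^sup>\<star> = e" "?h\<^sup>\<star> \<cdot> ?h = e"
      using assms(2) Suc by (simp_all add: pow_in_group_def)
    have "?g \<cdot> ?h \<cdot> (?g \<cdot> ?h)\<^sup>\<star> = ?g \<cdot> ((?h \<cdot> ?h\<^sup>\<star>) \<cdot> ?g\<^sup>\<star>)"
      using S by (simp add: iv_mul del: mult_Suc)
    also have "\<dots> = ?g \<cdot> ((?g\<^sup>\<star> \<cdot> ?g) \<cdot> ?g\<^sup>\<star>)" by (simp only: g h)
    also have "\<dots> = ?g \<cdot> ?g\<^sup>\<star>" using S by (simp del: mult_Suc)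
    also note g(1)
    finally have 1: "?g \<cdot> ?h \<cdot> (?g \<cdot> ?h)\<^sup>\<star> = e" .
    have "(?g \<cdot> ?h)\<^sup>\<star> \<cdot> (?g \<cdot> ?h) = ?h\<^sup>\<star> \<cdot> ((?g\<^sup>\<star> \<cdot> ?g) \<cdot> ?h)"
      using S by (simp add: iv_mul del: mult_Suc)
    also have "\<dots> = ?h\<^sup>\<star> \<cdot> ((?h \<cdot> ?h\<^sup>\<star>) \<cdot> ?h)" by (simp only: g h)
    also have "\<dots> = ?h\<^sup>\<star> \<cdot> ?h" using S by (simp del: mult_Suc)
    also note h(2)
    finally have 2: "(?g \<cdot> ?h)\<^sup>\<star> \<cdot> (?g \<cdot> ?h) = e" .
    show ?case unfolding pow_in_group_def p using 1 2 k by simp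
  qed (use assms in simp)
  then show ?thesis using \<open>0 < m\<close> by (cases m) auto
qed

text \<open>Both idempotents belong to the power with exponent \<open>l * k\<close>. This makes the
  description in \<open>pow_idem\<close> unambiguous.\<close>

lemma pow_in_group_unique:
  assumes "x \<in> S" "pow_in_group x k e" "pow_in_group x l f"
  shows "e = f"
proof -
  have "0 < k" "0 < l" using assms by (auto simp: pow_in_group_def)
  then have "pow_in_group x (l * k) e" "pow_in_group x (l * k) f"
    using pow_in_group_mult assms by (metis, metis mult.commute)
  then show ?thesis by (auto simp: pow_in_group_def)
qed

lemma pow_in_group_unit:
  assumes "x \<in> S" "pow_in_group x k e"
  shows "e \<cdot> sg_pow mul x k = sg_pow mul x k" "sg_pow mul x k \<cdot> e = sg_pow mul x k"
  using assms unfolding pow_in_group_def by (metis mul_assoc iv_closed mul_iv_mul sg_pow_closed)+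

text \<open>The element \<open>e \<cdot> (x \<cdot> e)\<close> is computed twice: writing the
  right-hand \<open>e\<close> as \<open>?g \<cdot> ?y\<close> yields \<open>x \<cdot> e\<close>,
  writing the left-hand one as \<open>?y \<cdot> ?g\<close> yields
  \<open>e \<cdot> x\<close>.\<close>

lemma pow_in_group_commute:
  assumes x: "x \<in> S" and g: "pow_in_group x k e"
  shows "e \<cdot> x = x \<cdot> e"
proof -
  let ?g = "sg_pow mul x k" and ?y = "(sg_pow mul x k)\<^sup>\<star>"
  have k: "0 < k" and e: "e \<in> E" and gy: "?g \<cdot> ?y = e" and yg: "?y \<cdot> ?g = e"
    using g by (auto simp: pow_in_group_def)
  have S: "?g \<in> S" "?y \<in> S" "e \<in> S" using x k e by simp_all
  have c: "x \<cdot> ?g = ?g \<cdot> x" using sg_pow_commute[OF x k] .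
  note u = pow_in_group_unit[OF x g]
  have "e \<cdot> (x \<cdot> e) = e \<cdot> (x \<cdot> ?g \<cdot> ?y)" using S x gy by simp
  also have "\<dots> = (e \<cdot> ?g) \<cdot> (x \<cdot> ?y)" unfolding c using S x by simp
  also have "\<dots> = (x \<cdot> ?g) \<cdot> ?y" unfolding u c using S x by simp
  also have "\<dots> = x \<cdot> e" using S x gy by simp
  finally have 1: "e \<cdot> (x \<cdot> e) = x \<cdot> e" .
  have "e \<cdot> (x \<cdot> e) = ?y \<cdot> (?g \<cdot> x) \<cdot> e" using S x yg[symmetric] by simp
  also have "\<dots> = ?y \<cdot> x \<cdot> (?g \<cdot> e)" unfolding c[symmetric] using S x by simp
  also have "\<dots> = ?y \<cdot> (x \<cdot> ?g)" unfolding u using S x by simp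
  also have "\<dots> = ?y \<cdot> ?g \<cdot> x" unfolding c using S x by simp
  finally show ?thesis using 1 yg by simp
qed

text \<open>Splitting one factor \<open>x\<close> off the power, on either side, leaves one-sided
  inverses of \<open>x\<close> relative to \<open>e\<close>. The case \<open>k = 1\<close> is
  separate because \<open>sg_pow\<close> has no meaningful value at exponent 0.\<close>

lemma pow_in_group_invertible:
  assumes x: "x \<in> S" and g: "pow_in_group x k e"
  obtains c d where "c \<in> S" "d \<in> S" "c \<cdot> x = e" "x \<cdot> d = e"
proof (cases "k = 1")
  case True
  then show ?thesis using that[of "x\<^sup>\<star>" "x\<^sup>\<star>"] x g by (simp add: pow_in_group_def)
next
  case False
  then obtain n where k: "k = Suc (Suc n)"
    using g by (metis One_nat_def not0_implies_Suc not_less_zero pow_in_group_def)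
  let ?h = "sg_pow mul x (Suc n)" and ?y = "(sg_pow mul x k)\<^sup>\<star>"
  have S: "?h \<in> S" "?y \<in> S" using x k by (simp_all del: sg_pow_Suc)
  have "sg_pow mul x k = ?h \<cdot> x" "sg_pow mul x k = x \<cdot> ?h"
    using sg_pow_commute[OF x, of "Suc n"] by (simp_all add: k)
  then have "?y \<cdot> (?h \<cdot> x) = e" "(x \<cdot> ?h) \<cdot> ?y = e"
    using g by (simp_all add: pow_in_group_def)
  then show ?thesis using that[of "?y \<cdot> ?h" "?h \<cdot> ?y"] S x by simp
qed

section \<open>Inverses and the natural order after adjoining an identity\<close>

lemma mem_S1 [simp]: "Elem a \<in> S1 S mul \<longleftrightarrow> a \<in> S"
  by (auto simp: S1_def)

lemma sg_inv_S1_Elem: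
  assumes "a \<in> S"
  shows "sg_inv (S1 S mul) (mul1 mul) (Elem a) = Elem (a\<^sup>\<star>)"
  unfolding sg_inv_def[of "S1 S mul"]
proof (rule the_equality)
  show "is_inverse_of (S1 S mul) (mul1 mul) (Elem a) (Elem (a\<^sup>\<star>))"
    using assms by (simp add: is_inverse_of_def)
next
  fix b assume "is_inverse_of (S1 S mul) (mul1 mul) (Elem a) b"
  then show "b = Elem (a\<^sup>\<star>)"
    using assms iv_eqI[of a] by (cases b) (auto simp: is_inverse_of_def)
qed

lemma sg_inv_S1_One:
  assumes "One \<in> S1 S mul"
  shows "sg_inv (S1 S mul) (mul1 mul) One = One"
  unfolding sg_inv_def
proof (rule the_equality)
  show "is_inverse_of (S1 S mul) (mul1 mul) One One"
    using assms by (simp add: is_inverse_of_def)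
next
  fix b assume "is_inverse_of (S1 S mul) (mul1 mul) One b"
  then show "b = One" by (cases b) (auto simp: is_inverse_of_def)
qed

text \<open>The idempotent witnessing the order may be \<open>One\<close>, in which case
  \<open>e = f\<close>; otherwise the equation follows from \<open>f \<cdot> f = f\<close>.
  Conversely \<open>Elem e\<close> is a witness.\<close>

lemma nat_le_S1_Elem:
  assumes "e \<in> E" "f \<in> E"
  shows "nat_le (S1 S mul) (mul1 mul) (Elem e) (Elem f) \<longleftrightarrow> e \<cdot> f = e"
proof
  assume "nat_le (S1 S mul) (mul1 mul) (Elem e) (Elem f)"
  then obtain p where p: "p \<in> S1 S mul" "Elem e = mul1 mul p (Elem f)"
    by (auto simp: nat_le_def idempotents_def[of "S1 S mul"])
  then show "e \<cdot> f = e" using assms by (cases p) auto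
next
  assume "e \<cdot> f = e"
  then show "nat_le (S1 S mul) (mul1 mul) (Elem e) (Elem f)"
    unfolding nat_le_def
    by (intro bexI[of _ "Elem e"]) (use assms in \<open>auto simp: idempotents_def[of "S1 S mul"]\<close>)
qed

section \<open>Conjugacy of an element with its product by an idempotent\<close>

lemma conj_pI: "u \<in> S \<Longrightarrow> v \<in> S \<Longrightarrow> conj_p S mul (u \<cdot> v) (v \<cdot> u)"
  unfolding conj_p_def
  by (intro conjI, simp, simp, rule bexI[of _ "Elem u"], rule bexI[of _ "Elem v"]) simp_all

text \<open>If a factor is \<open>One\<close>, both products equal the other factor, so beyond
  equality only factors from \<open>S\<close> remain.\<close>

lemma conj_pE:
  assumes "conj_p S mul x y"
  obtains "x = y" | u v where "u \<in> S" "v \<in> S" "x = u \<cdot> v" "y = v \<cdot> u"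
proof -
  obtain u v where "u \<in> S1 S mul" "v \<in> S1 S mul" "Elem x = mul1 mul u v" "Elem y = mul1 mul v u"
    using assms by (auto simp: conj_p_def)
  then show ?thesis using that by (cases u; cases v) auto
qed

lemma conj_rel_sym: "conj_rel S mul x y \<Longrightarrow> conj_rel S mul y x"
proof -
  have "symp (conj_p S mul)" by (auto simp: symp_def conj_p_def)
  then show "conj_rel S mul x y \<Longrightarrow> conj_rel S mul y x"
    unfolding conj_rel_def by (rule sympD[OF sym_trancl[to_pred]])
qed

lemma conj_rel_trans: "conj_rel S mul x y \<Longrightarrow> conj_rel S mul y z \<Longrightarrow> conj_rel S mul x z"
  unfolding conj_rel_def by (rule tranclp_trans)

lemma conj_relI: "u \<in> S \<Longrightarrow> v \<in> S \<Longrightarrow> conj_rel S mul (u \<cdot> v) (v \<cdot> u)"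
  unfolding conj_rel_def by (intro tranclp.r_into_trancl conj_pI)

text \<open>\<open>One\<close> need not belong to \<open>S1 S mul\<close>, so a nontrivial
  factorization is used: \<open>x = x \<cdot> (x\<^sup>\<star> \<cdot> x)\<close> is conjugate to
  the swapped product, and symmetry leads back.\<close>

lemma conj_rel_refl: "x \<in> S \<Longrightarrow> conj_rel S mul x x"
  by (metis conj_relI conj_rel_sym conj_rel_trans iv_closed mul_closed mul_iv_mul)

lemma conj_rel_pow_iv:
  assumes x: "x \<in> S"
  shows "conj_rel S mul x (x \<cdot> (sg_pow mul x (Suc n) \<cdot> (sg_pow mul x (Suc n))\<^sup>\<star>))"
proof (induction n)
  case 0
  show ?case using conj_relI[of "x \<cdot> x\<^sup>\<star>" x] x by simp
next
  case (Suc n)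
  let ?h = "sg_pow mul x (Suc n)"
  define g where "g = x \<cdot> ?h"
  have h: "?h \<in> S" and g: "g \<in> S" using x by (simp_all add: g_def del: sg_pow_Suc)
  have p: "sg_pow mul x (Suc (Suc n)) = g" "g = ?h \<cdot> x"
    using sg_pow_commute[OF x, of "Suc n"] by (simp_all add: g_def)
  \<comment> \<open>These factors are chosen so that one order of multiplication gives the element
    for exponent \<open>Suc n\<close> and the other the element for the next exponent.\<close>
  have r: "conj_rel S mul ((g \<cdot> g\<^sup>\<star>) \<cdot> (g \<cdot> ?h\<^sup>\<star>)) ((g \<cdot> ?h\<^sup>\<star>) \<cdot> (g \<cdot> g\<^sup>\<star>))"
    by (rule conj_relI) (use g h in simp_all)
  have "(g \<cdot> g\<^sup>\<star>) \<cdot> (g \<cdot> ?h\<^sup>\<star>) = g \<cdot> ?h\<^sup>\<star>"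
    using g h by (simp del: sg_pow_Suc)
  also have "\<dots> = x \<cdot> (?h \<cdot> ?h\<^sup>\<star>)"
    using h x by (simp add: g_def del: sg_pow_Suc)
  finally have 1: "(g \<cdot> g\<^sup>\<star>) \<cdot> (g \<cdot> ?h\<^sup>\<star>) = x \<cdot> (?h \<cdot> ?h\<^sup>\<star>)" .
  \<comment> \<open>The first \<open>g\<close> is read as \<open>x \<cdot> ?h\<close> and the second
    as \<open>?h \<cdot> x\<close>, so that \<open>?h \<cdot> ?h\<^sup>\<star> \<cdot> ?h\<close>
    collapses.\<close>
  have "(g \<cdot> ?h\<^sup>\<star>) \<cdot> (g \<cdot> g\<^sup>\<star>) = (x \<cdot> ?h \<cdot> ?h\<^sup>\<star>) \<cdot> (?h \<cdot> x \<cdot> g\<^sup>\<star>)"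
    using g_def p(2) by metis
  also have "\<dots> = x \<cdot> (?h \<cdot> x \<cdot> g\<^sup>\<star>)" using g h x by (simp del: sg_pow_Suc)
  also have "\<dots> = x \<cdot> (g \<cdot> g\<^sup>\<star>)" by (simp only: p(2)[symmetric])
  finally have 2: "(g \<cdot> ?h\<^sup>\<star>) \<cdot> (g \<cdot> g\<^sup>\<star>) = x \<cdot> (g \<cdot> g\<^sup>\<star>)" .
  show ?case using Suc r conj_rel_trans unfolding p(1) 1 2 by blast
qed

lemma conj_rel_mul_idem:
  assumes "x \<in> S" "pow_in_group x k e"
  shows "conj_rel S mul x (x \<cdot> e)"
  using conj_rel_pow_iv[OF assms(1), of "k - 1"] assms(2) by (simp add: pow_in_group_def)

text \<open>
  Since \<open>(xg)\<^sup>n e = x\<^sup>n e\<close>, the equality of powers only needs \<open>(xg)\<^sup>n \<le> x\<^sup>n\<close> in the natural order.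
\<close>

lemma pow_in_group_mul_idem:
  assumes x: "x \<in> S" and k: "pow_in_group x k e" and g: "g \<in> E" and ge: "e \<cdot> g = e"
  shows "pow_in_group (x \<cdot> g) k e"
proof -
  have e: "e \<in> E" "0 < k" using k by (simp_all add: pow_in_group_def)
  note xe = pow_in_group_commute[OF x k]
  have gS: "g \<in> S" "e \<in> S" using g e by simp_all
  have ge': "g \<cdot> e = e" using idem_commute[OF g e(1)] ge by simp
  \<comment> \<open>As \<open>g\<close> commutes with \<open>h\<^sup>\<star> \<cdot> h\<close>, one
    has \<open>h \<cdot> g = (h \<cdot> g \<cdot> h\<^sup>\<star>) \<cdot> h\<close> with an
    idempotent in front. This moves every \<open>g\<close> to the left, for \<open>h\<close> a power
    of \<open>x\<close>.\<close>
  have 1: "\<exists>p\<in>E. sg_pow mul (x \<cdot> g) (Suc n) = p \<cdot> sg_pow mul x (Suc n)" for n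
  proof (induction n)
    case 0
    have "x \<cdot> g = x \<cdot> g \<cdot> x\<^sup>\<star> \<cdot> x"
      using idem_commute[OF iv_mul_idem[OF x] g] mul_iv_mul_left[OF x gS(1)] x gS by simp
    moreover have "x \<cdot> g \<cdot> x\<^sup>\<star> \<in> E"
      using idem_left_commute[OF iv_mul_idem[OF x] g, of "x\<^sup>\<star>"] x g gS by (intro idemI) simp_all
    ultimately show ?case using x by (metis sg_pow_1)
  next
    case (Suc n)
    then obtain p where p: "p \<in> E" "sg_pow mul (x \<cdot> g) (Suc n) = p \<cdot> sg_pow mul x (Suc n)"
      by blast
    let ?h = "sg_pow mul x (Suc (Suc n))"
    have h: "?h \<in> S" using x by (simp del: sg_pow_Suc)
    have pS: "p \<in> S" "sg_pow mul x (Suc n) \<in> S" using p x by (simp_all del: sg_pow_Suc)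
    have "sg_pow mul (x \<cdot> g) (Suc (Suc n)) = p \<cdot> sg_pow mul x (Suc n) \<cdot> (x \<cdot> g)"
      using p(2) by simp
    also have "\<dots> = p \<cdot> (?h \<cdot> g)"
      using x gS pS by simp
    also have "\<dots> = p \<cdot> (?h \<cdot> g \<cdot> ?h\<^sup>\<star>) \<cdot> ?h"
      using idem_commute[OF iv_mul_idem[OF h] g] mul_iv_mul_left[OF h gS(1)] h gS pS
      by (simp del: sg_pow_Suc)
    finally have "sg_pow mul (x \<cdot> g) (Suc (Suc n)) = p \<cdot> (?h \<cdot> g \<cdot> ?h\<^sup>\<star>) \<cdot> ?h" .
    moreover have "?h \<cdot> g \<cdot> ?h\<^sup>\<star> \<in> E"
      using idem_left_commute[OF iv_mul_idem[OF h] g, of "?h\<^sup>\<star>"] h g gS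
      by (intro idemI) (simp_all del: sg_pow_Suc)
    ultimately show ?case using idem_mul[OF p(1)] by blast
  qed
  have 2: "sg_pow mul (x \<cdot> g) (Suc n) \<cdot> e = sg_pow mul x (Suc n) \<cdot> e" for n
  proof (induction n)
    case 0
    show ?case using x gS ge' by simp
  next
    case (Suc n)
    let ?w = "sg_pow mul (x \<cdot> g) (Suc n)" and ?h = "sg_pow mul x (Suc n)"
    have S: "?w \<in> S" "?h \<in> S" using x gS by (simp_all del: sg_pow_Suc)
    have "sg_pow mul (x \<cdot> g) (Suc (Suc n)) \<cdot> e = ?w \<cdot> (x \<cdot> e)"
      using S x gS ge' by simp
    also have "\<dots> = (?w \<cdot> e) \<cdot> x" unfolding xe[symmetric] using S x gS by simp
    also have "\<dots> = ?h \<cdot> (e \<cdot> x)" unfolding Suc using S x gS by simp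
    also have "\<dots> = sg_pow mul x (Suc (Suc n)) \<cdot> e" unfolding xe using S x gS by simp
    finally show ?case .
  qed
  obtain n where n: "k = Suc n" using e by (cases k) auto
  obtain p where p: "p \<in> E" "sg_pow mul (x \<cdot> g) k = p \<cdot> sg_pow mul x k"
    using 1 n by blast
  note u = pow_in_group_unit(2)[OF x k]
  \<comment> \<open>Since the k-th power of \<open>x\<close> absorbs \<open>e\<close>, so does its
    product with \<open>p\<close>; fact 2 then identifies the two k-th powers.\<close>
  have "sg_pow mul (x \<cdot> g) k \<cdot> e = p \<cdot> (sg_pow mul x k \<cdot> e)"
    unfolding p(2) using p(1) x e gS by simp
  then have "sg_pow mul (x \<cdot> g) k = sg_pow mul x k"
    using 2[of n] u p(2) unfolding n by simp
  then show ?thesis using k by (simp add: pow_in_group_def)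
qed

end

section \<open>The idempotent of an element in the group-bound case\<close>

locale group_bound_inverse_sgroup = inverse_sgroup +
  assumes group_bound: "group_bound S mul"
begin

lemma pow_in_group_pow_idem:
  assumes "x \<in> S"
  obtains k where "pow_in_group x k (pow_idem S mul x)"
proof -
  obtain k G e where k: "k \<ge> 1" "subgroup_with_identity S mul G e" "sg_pow mul x k \<in> G"
    using group_bound assms by (auto simp: group_bound_def)
  have "pow_idem S mul x = e"
    unfolding pow_idem_def
  proof (rule the_equality)
    show "\<exists>k\<ge>1. \<exists>G. subgroup_with_identity S mul G e \<and> sg_pow mul x k \<in> G" using k by blast
  next
    fix f assume "\<exists>k\<ge>1. \<exists>G. subgroup_with_identity S mul G f \<and> sg_pow mul x k \<in> G"
    then show "f = e" using pow_in_groupI k pow_in_group_unique[OF assms] by metis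
  qed
  then show ?thesis using that pow_in_groupI k by metis
qed

abbreviation ep where "ep x \<equiv> pow_idem S mul x"

lemma ep_idem [simp]: "x \<in> S \<Longrightarrow> ep x \<in> E"
  using pow_in_group_pow_idem pow_in_group_def by metis

lemma ep_commute: "x \<in> S \<Longrightarrow> ep x \<cdot> x = x \<cdot> ep x"
  using pow_in_group_pow_idem pow_in_group_commute by metis

lemma ep_invertible:
  assumes "x \<in> S"
  obtains c d where "c \<in> S" "d \<in> S" "c \<cdot> x = ep x" "x \<cdot> d = ep x"
  using pow_in_group_pow_idem pow_in_group_invertible assms by metis

lemma conj_rel_ep: "x \<in> S \<Longrightarrow> conj_rel S mul x (x \<cdot> ep x)"
  using pow_in_group_pow_idem conj_rel_mul_idem by metis

lemma ep_mul_idem: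
  assumes "x \<in> S" "g \<in> E" "ep x \<cdot> g = ep x"
  shows "ep (x \<cdot> g) = ep x"
  using assms pow_in_group_pow_idem pow_in_group_mul_idem pow_in_group_unique
  by (metis idem_closed mul_closed)

section \<open>The partial action stays within conjugacy classes\<close>

lemma act_Elem:
  assumes "a \<in> S" "x \<in> S"
  shows "act S mul (Elem a) x = Some z \<longleftrightarrow> ep x \<cdot> (a\<^sup>\<star> \<cdot> a) = ep x \<and> z = a \<cdot> (x \<cdot> a\<^sup>\<star>)"
  using assms by (auto simp: act_def Let_def sg_inv_S1_Elem nat_le_S1_Elem)

lemma act_One: "One \<in> S1 S mul \<Longrightarrow> act S mul One x = Some z \<Longrightarrow> z = x"
  by (auto simp: act_def Let_def sg_inv_S1_One split: if_splits)

lemma conj_rel_act: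
  assumes x: "x \<in> S" and a: "a \<in> S1 S mul" "act S mul a x = Some z"
  shows "conj_rel S mul x z"
proof (cases a)
  case One
  then show ?thesis using act_One conj_rel_refl assms by blast
next
  case (Elem b)
  define g where "g = b\<^sup>\<star> \<cdot> b"
  have b: "b \<in> S" and z: "ep x \<cdot> g = ep x" "z = b \<cdot> (x \<cdot> b\<^sup>\<star>)"
    using assms act_Elem Elem by (auto simp: g_def)
  have g: "g \<in> E" using b by (simp add: g_def)
  have ep: "ep (x \<cdot> g) = ep x" by (rule ep_mul_idem) (use x g z in simp_all)
  have "conj_rel S mul (x \<cdot> g) (x \<cdot> g \<cdot> ep x)"
    using conj_rel_ep[of "x \<cdot> g"] x g ep by simp
  moreover have "x \<cdot> g \<cdot> ep x = x \<cdot> ep x"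
    using x g z(1) idem_commute[OF g ep_idem[OF x]] by simp
  \<comment> \<open>Here \<open>x \<cdot> g\<close> factors as
    \<open>x \<cdot> b\<^sup>\<star>\<close> times \<open>b\<close>, and swapping the factors gives
    \<open>z\<close>.\<close>
  moreover have "conj_rel S mul (x \<cdot> g) z"
    using conj_relI[of "x \<cdot> b\<^sup>\<star>" b] x b by (simp add: z(2) g_def)
  ultimately show ?thesis using conj_rel_ep[OF x] conj_rel_sym conj_rel_trans by metis
qed

lemma act_conj_imp_conj_rel: "act_conj S mul x y \<Longrightarrow> conj_rel S mul x y"
  unfolding act_conj_def
proof (induction rule: tranclp_induct)
  case (base y)
  then show ?case using conj_rel_act conj_rel_sym unfolding act_conj_p_def by metis
next
  case (step y z)
  then have "conj_rel S mul y z" using conj_rel_act conj_rel_sym unfolding act_conj_p_def by metis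
  then show ?case using step conj_rel_trans by blast
qed

section \<open>Linked elements and their common translate\<close>

definition linked :: "'a \<Rightarrow> 'a \<Rightarrow> bool" where
  "linked x y \<longleftrightarrow> x \<in> S \<and> y \<in> S \<and>
     (\<exists>b\<in>S. b\<^sup>\<star> \<cdot> b = ep x \<and> b \<cdot> b\<^sup>\<star> = ep y \<and> b \<cdot> (x \<cdot> b\<^sup>\<star>) = y \<cdot> ep y)"

lemma linked_refl:
  assumes "x \<in> S"
  shows "linked x x"
  unfolding linked_def using assms ep_commute[of x]
  by (auto intro!: bexI[of _ "ep x"]) (metis ep_idem idem_closed idem_idem mul_assoc)

text \<open>View \<open>b\<close> as an arrow from \<open>b\<^sup>\<star> \<cdot> b\<close> to
  \<open>b \<cdot> b\<^sup>\<star>\<close>. Because \<open>linked\<close> demands equality with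
  \<open>ep x\<close> and \<open>ep y\<close>, where \<open>act\<close> only asks for an inequality,
  the arrows compose to \<open>c \<cdot> b\<close> and \<open>ep y\<close> is absorbed in the
  middle.\<close>

lemma linked_trans:
  assumes "linked x y" "linked y z"
  shows "linked x z"
proof -
  obtain b c where S: "x \<in> S" "y \<in> S" "z \<in> S" "b \<in> S" "c \<in> S"
    and b: "b\<^sup>\<star> \<cdot> b = ep x" "b \<cdot> b\<^sup>\<star> = ep y" "b \<cdot> (x \<cdot> b\<^sup>\<star>) = y \<cdot> ep y"
    and c: "c\<^sup>\<star> \<cdot> c = ep y" "c \<cdot> c\<^sup>\<star> = ep z" "c \<cdot> (y \<cdot> c\<^sup>\<star>) = z \<cdot> ep z"
    using assms by (auto simp: linked_def)
  have e: "ep y \<in> S" using S by simp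
  have eb: "ep y \<cdot> b = b" using b(2)[symmetric] S by simp
  have ec: "ep y \<cdot> c\<^sup>\<star> = c\<^sup>\<star>" using c(1)[symmetric] S by simp
  have "(c \<cdot> b)\<^sup>\<star> \<cdot> (c \<cdot> b) = b\<^sup>\<star> \<cdot> ((c\<^sup>\<star> \<cdot> c) \<cdot> b)" using S by (simp add: iv_mul)
  also have "\<dots> = ep x" using b c eb by simp
  finally have 1: "(c \<cdot> b)\<^sup>\<star> \<cdot> (c \<cdot> b) = ep x" .
  have "(c \<cdot> b) \<cdot> (c \<cdot> b)\<^sup>\<star> = c \<cdot> ((b \<cdot> b\<^sup>\<star>) \<cdot> c\<^sup>\<star>)" using S by (simp add: iv_mul)
  also have "\<dots> = ep z" using b c ec by simp
  finally have 2: "(c \<cdot> b) \<cdot> (c \<cdot> b)\<^sup>\<star> = ep z" .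
  have "(c \<cdot> b) \<cdot> (x \<cdot> (c \<cdot> b)\<^sup>\<star>) = c \<cdot> ((b \<cdot> (x \<cdot> b\<^sup>\<star>)) \<cdot> c\<^sup>\<star>)" using S by (simp add: iv_mul)
  also have "\<dots> = c \<cdot> (y \<cdot> (ep y \<cdot> c\<^sup>\<star>))" unfolding b(3) using S e by simp
  also have "\<dots> = z \<cdot> ep z" unfolding ec by (rule c)
  finally have 3: "(c \<cdot> b) \<cdot> (x \<cdot> (c \<cdot> b)\<^sup>\<star>) = z \<cdot> ep z" .
  show ?thesis unfolding linked_def using S 1 2 3 by (auto intro!: bexI[of _ "c \<cdot> b"])
qed

text \<open>The relation \<open>v \<cdot> x = y \<cdot> v\<close> passes to powers and from there to
  the idempotents. Invertibility of \<open>x\<close> and \<open>y\<close> relative to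
  \<open>e\<close> and \<open>f\<close> then shows that \<open>v \<cdot> e\<close> has exactly these
  two idempotents.\<close>

lemma linked_mul_commute:
  assumes u: "u \<in> S" and v: "v \<in> S"
  shows "linked (u \<cdot> v) (v \<cdot> u)"
proof -
  define x where "x = u \<cdot> v"
  define y where "y = v \<cdot> u"
  define e where "e = ep x"
  define f where "f = ep y"
  have x: "x \<in> S" and y: "y \<in> S" using u v by (simp_all add: x_def y_def)
  have e: "e \<in> E" and f: "f \<in> E" using x y by (simp_all add: e_def f_def)
  have S: "e \<in> S" "f \<in> S" using e f by simp_all
  have xe: "e \<cdot> x = x \<cdot> e" and yf: "f \<cdot> y = y \<cdot> f"
    using ep_commute x y by (simp_all add: e_def f_def)
  have vx: "v \<cdot> x = y \<cdot> v" using u v by (simp add: x_def y_def)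
  obtain k l where kl: "pow_in_group x k e" "pow_in_group y l f"
    using pow_in_group_pow_idem x y e_def f_def by metis
  then have pos: "0 < k" "0 < l" by (simp_all add: pow_in_group_def)
  have "pow_in_group x (l * k) e" "pow_in_group y (l * k) f"
    using pow_in_group_mult[OF x kl(1) pos(2)] pow_in_group_mult[OF y kl(2) pos(1)]
    by (simp_all add: mult.commute)
  \<comment> \<open>A common exponent is needed, since the relation between powers compares equal
    exponents only; \<open>Suc n\<close> suits the induction below.\<close>
  moreover obtain n where "l * k = Suc n" using pos by (metis gr0_conv_Suc nat_0_less_mult_iff)
  ultimately have n: "pow_in_group x (Suc n) e" "pow_in_group y (Suc n) f" by simp_all
  have vxn: "v \<cdot> sg_pow mul x (Suc m) = sg_pow mul y (Suc m) \<cdot> v" for m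
  proof (induction m)
    case (Suc m)
    have s: "sg_pow mul x (Suc m) \<in> S" "sg_pow mul y (Suc m) \<in> S"
      using x y by (simp_all del: sg_pow_Suc)
    have "v \<cdot> sg_pow mul x (Suc (Suc m)) = (v \<cdot> sg_pow mul x (Suc m)) \<cdot> x" using v x s by simp
    also have "\<dots> = sg_pow mul y (Suc m) \<cdot> (v \<cdot> x)" unfolding Suc using v x s by simp
    also have "\<dots> = sg_pow mul y (Suc (Suc m)) \<cdot> v" unfolding vx using v y s by simp
    finally show ?case .
  qed (use vx in simp)
  let ?g = "sg_pow mul x (Suc n)" and ?h = "sg_pow mul y (Suc n)"
  have gh: "?g \<in> S" "?h \<in> S" using x y by (simp_all del: sg_pow_Suc)
  have ge: "?g \<cdot> e = ?g" and fh: "f \<cdot> ?h = ?h"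
    using pow_in_group_unit[OF x n(1)] pow_in_group_unit[OF y n(2)] by simp_all
  have ie: "?g \<cdot> ?g\<^sup>\<star> = e" "?h\<^sup>\<star> \<cdot> ?h = f" using n by (simp_all add: pow_in_group_def)
  \<comment> \<open>First \<open>f\<close> is shown to fix \<open>v \<cdot> e\<close> from the left;
    then, symmetrically, \<open>e\<close> is shown to fix \<open>f \<cdot> v\<close> from the right.
    Together these give \<open>v \<cdot> e = f \<cdot> v\<close>.\<close>
  have "v \<cdot> e = (v \<cdot> ?g) \<cdot> ?g\<^sup>\<star>" using ie gh v by simp
  also have "\<dots> = f \<cdot> (v \<cdot> e)"
  proof -
    have "(v \<cdot> ?g) \<cdot> ?g\<^sup>\<star> = (f \<cdot> ?h) \<cdot> v \<cdot> ?g\<^sup>\<star>" unfolding fh vxn ..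
    also have "\<dots> = f \<cdot> ((?h \<cdot> v) \<cdot> ?g\<^sup>\<star>)" using gh v S by simp
    also have "\<dots> = f \<cdot> (v \<cdot> e)" unfolding vxn[symmetric] using gh v ie by simp
    finally show ?thesis .
  qed
  finally have 1: "v \<cdot> e = f \<cdot> (v \<cdot> e)" .
  have "f \<cdot> v = ?h\<^sup>\<star> \<cdot> (?h \<cdot> v)" using mul_left_eq[OF ie(2) _ gh(2) v] gh by simp
  also have "\<dots> = ?h\<^sup>\<star> \<cdot> (v \<cdot> (?g \<cdot> e))" unfolding ge vxn ..
  also have "\<dots> = ?h\<^sup>\<star> \<cdot> ((v \<cdot> ?g) \<cdot> e)" using gh v S by simp
  also have "\<dots> = (?h\<^sup>\<star> \<cdot> ?h) \<cdot> (v \<cdot> e)" unfolding vxn using gh v S by simp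
  finally have 2: "v \<cdot> e = f \<cdot> v" using 1 ie by simp
  define a where "a = v \<cdot> e"
  have a: "a \<in> S" using v S by (simp add: a_def)
  have ae: "a \<cdot> e = a" using v e S by (simp add: a_def)
  have fa: "f \<cdot> a = a" using 1 by (simp add: a_def)
  \<comment> \<open>The elements \<open>c \<cdot> u\<close> and \<open>u \<cdot> d\<close> become
    one-sided inverses of \<open>a\<close> relative to \<open>e\<close> and
    \<open>f\<close>.\<close>
  obtain c where c: "c \<in> S" "c \<cdot> x = e" using ep_invertible[OF x] unfolding e_def by metis
  obtain d where d: "d \<in> S" "y \<cdot> d = f" using ep_invertible[OF y] unfolding f_def by metis
  have ca: "(c \<cdot> u) \<cdot> a = e"
  proof -
    have "(c \<cdot> u) \<cdot> a = (c \<cdot> x) \<cdot> e" using c(1) u v S by (simp add: a_def x_def)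
    then show ?thesis using c e by simp
  qed
  have ad: "a \<cdot> (u \<cdot> d) = f"
  proof -
    have "a \<cdot> (u \<cdot> d) = f \<cdot> (y \<cdot> d)" unfolding a_def 2 using d(1) u v S by (simp add: y_def)
    then show ?thesis using d f by simp
  qed
  have 3: "a\<^sup>\<star> \<cdot> a = e"
  proof -
    \<comment> \<open>The left inverse gives \<open>e\<close> below
      \<open>a\<^sup>\<star> \<cdot> a\<close>, and \<open>a \<cdot> e = a\<close> gives the reverse
      inequality.\<close>
    have "e \<cdot> (a\<^sup>\<star> \<cdot> a) = (c \<cdot> u) \<cdot> (a \<cdot> (a\<^sup>\<star> \<cdot> a))"
      unfolding ca[symmetric] using c u a by simp
    also have "\<dots> = e" using ca a by simp
    finally have "e = (a\<^sup>\<star> \<cdot> a) \<cdot> e" using idem_commute[OF e iv_mul_idem[OF a]] by simp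
    also have "\<dots> = a\<^sup>\<star> \<cdot> a" using ae a S by simp
    finally show ?thesis by simp
  qed
  have 4: "a \<cdot> a\<^sup>\<star> = f"
  proof -
    have "(a \<cdot> a\<^sup>\<star>) \<cdot> f = f"
      unfolding ad[symmetric] using d u a by simp
    then have "f = f \<cdot> (a \<cdot> a\<^sup>\<star>)" using idem_commute[OF f mul_iv_idem[OF a]] by simp
    also have "\<dots> = (f \<cdot> a) \<cdot> a\<^sup>\<star>" using a S by simp
    finally show ?thesis using fa by simp
  qed
  have "a \<cdot> (x \<cdot> a\<^sup>\<star>) = v \<cdot> (e \<cdot> x) \<cdot> a\<^sup>\<star>" using a v x S by (simp add: a_def)
  also have "\<dots> = (v \<cdot> x) \<cdot> (e \<cdot> a\<^sup>\<star>)" unfolding xe using a v x S by simp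
  also have "\<dots> = y \<cdot> (a \<cdot> a\<^sup>\<star>)" unfolding vx a_def[symmetric] using a v y S by (simp add: a_def)
  finally have 5: "a \<cdot> (x \<cdot> a\<^sup>\<star>) = y \<cdot> f" using 4 by simp
  show ?thesis
    unfolding linked_def x_def[symmetric] y_def[symmetric]
    using a x y 3 4 5 by (auto simp: e_def f_def intro!: bexI[of _ a])
qed

lemma conj_p_imp_linked: "conj_p S mul x y \<Longrightarrow> linked x y"
proof -
  assume xy: "conj_p S mul x y"
  then have "x \<in> S" by (simp add: conj_p_def)
  then show "linked x y" using xy linked_refl linked_mul_commute by (metis conj_pE)
qed

lemma conj_rel_imp_linked: "conj_rel S mul x y \<Longrightarrow> linked x y"
  unfolding conj_rel_def
  by (induction rule: tranclp_induct) (auto intro: conj_p_imp_linked linked_trans)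

lemma linked_common_translate:
  assumes "linked x y"
  shows "\<exists>z\<in>S. \<exists>a\<in>S1 S mul. \<exists>b\<in>S1 S mul. act S mul a x = Some z \<and> act S mul b y = Some z"
proof -
  obtain b where S: "x \<in> S" "y \<in> S" "b \<in> S"
    and b: "b\<^sup>\<star> \<cdot> b = ep x" "b \<cdot> (x \<cdot> b\<^sup>\<star>) = y \<cdot> ep y"
    using assms by (auto simp: linked_def)
  have "ep y \<cdot> (y \<cdot> ep y) = y \<cdot> ep y"
    using ep_commute S by (metis ep_idem idem_closed idem_idem mul_assoc)
  then have "act S mul (Elem b) x = Some (y \<cdot> ep y)" "act S mul (Elem (ep y)) y = Some (y \<cdot> ep y)"
    using S b by (simp_all add: act_Elem)
  then show ?thesis using S by (metis ep_idem idem_closed mem_S1 mul_closed)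
qed

lemma act_conj_common_translate:
  assumes "x \<in> S" "y \<in> S" "z \<in> S" "a \<in> S1 S mul" "b \<in> S1 S mul"
    and "act S mul a x = Some z" "act S mul b y = Some z"
  shows "act_conj S mul x y"
proof -
  have "act_conj_p S mul x z" "act_conj_p S mul z y"
    using assms unfolding act_conj_p_def by blast+
  then show ?thesis unfolding act_conj_def
    by (blast intro: tranclp_trans tranclp.r_into_trancl)
qed

end

theorem theorem3:
  fixes S :: "'a set" and mul :: "'a \<Rightarrow> 'a \<Rightarrow> 'a" and x y :: 'a
  assumes "inverse_sgroup S mul"
    and "group_bound S mul"
    and "x \<in> S" and "y \<in> S"
  shows "(conj_rel S mul x y \<longleftrightarrow> act_conj S mul x y) \<and>
         (act_conj S mul x y \<longleftrightarrow>
           (\<exists>z\<in>S. \<exists>a\<in>S1 S mul. \<exists>b\<in>S1 S mul.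
              act S mul a x = Some z \<and> act S mul b y = Some z))"
proof -
  interpret group_bound_inverse_sgroup S mul
    using assms by (simp add: group_bound_inverse_sgroup_def group_bound_inverse_sgroup_axioms_def)
  let ?c = "\<exists>z\<in>S. \<exists>a\<in>S1 S mul. \<exists>b\<in>S1 S mul. act S mul a x = Some z \<and> act S mul b y = Some z"
  \<comment> \<open>The three conditions are closed into the cycle (b) to (a) to (c) to (b).\<close>
  have "act_conj S mul x y \<Longrightarrow> conj_rel S mul x y" by (rule act_conj_imp_conj_rel)
  moreover have "conj_rel S mul x y \<Longrightarrow> ?c" by (intro linked_common_translate conj_rel_imp_linked)
  moreover have "?c \<Longrightarrow> act_conj S mul x y" using act_conj_common_translate assms(3,4) by blast
  ultimately show ?thesis by satx
qed

end
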